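(* Let $n$ be an odd positive integer. Then $$2160\sum_{m=1}^{n-1}\left[\sigma_3^{\dagger}(m)\sigma_7^{\dagger}(n-m)-\sigma_5^{\dagger}(m)\sigma_5^{\dagger}(n-m)\right]+186480\sum_{m=1}^{n-1}\left[\sigma_3(m)\sigma_7(n-m)-\sigma_5(m)\sigma_5(n-m)\right]$$ $$=759\,\sigma_3(n)-200\,\sigma_5(n)-642\,\sigma_7(n)+83\,\sigma_{11}(n).$$
   Context: For positive integers $r,n$, $\sigma_r(n):=\sum_{d\mid n,\,d>0}d^r$ and $\sigma_r^{\dagger}(n):=\sum_{d\mid n,\,d>0}(-1)^{d}d^r$. *)

theory Defs
  imports Main
begin

text \<open>
  Both functions are meant for \<open>n > 0\<close>. Values are integers because
  the alternating divisor sum may be negative.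
\<close>

definition divisor_sigma :: "nat \<Rightarrow> nat \<Rightarrow> int" where
  "divisor_sigma r n = (\<Sum>d | d dvd n \<and> d > 0. int d ^ r)"

definition divisor_sigma_dagger :: "nat \<Rightarrow> nat \<Rightarrow> int" where
  "divisor_sigma_dagger r n = (\<Sum>d | d dvd n \<and> d > 0. (-1) ^ d * int d ^ r)"

end

theory Submission
  imports Defs
begin

text \<open>
  The convolution sums are sums of polynomials in \<open>(a, b)\<close>, weighted by the parity of \<open>a + b\<close>,
  over the positive solutions of \<open>a x + b y = n\<close>. On these solutions the subtractive Euclidean step
  \<open>(a, b, x, y) \<mapsto> (a - b, b, x, x + y)\<close> is a bijection from \<open>a > b\<close> onto \<open>y > x\<close>, so a summand of
  the form \<open>f - f \<circ> step\<close>, with \<open>f\<close> invariant under exchanging \<open>(a, x)\<close> with \<open>(b, y)\<close>, has a sum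
  that collapses to the sum of \<open>f\<close> over \<open>x = y\<close>, which is a divisor sum. For odd \<open>n\<close> there are six
  parity classes of solutions, permuted by the step, and \<open>f\<close> may be a different polynomial on each.
  The summand of the theorem takes this form once one adds multiples of
  \<open>[2 dvd b] a^i b^j - 2^j [2 dvd y] a^i b^j\<close>, whose sum vanishes because
  \<open>(a, b, x, y) \<mapsto> (a, b/2, x, 2y)\<close> exchanges the two conditions.
\<close>

section \<open>Sums over the positive solutions of \<open>a * x + b * y = n\<close>\<close>

definition quads :: "nat \<Rightarrow> (nat \<times> nat \<times> nat \<times> nat) set" where
  "quads n = {(a, b, x, y). 0 < a \<and> 0 < b \<and> 0 < x \<and> 0 < y \<and> a * x + b * y = n}"

lemma finite_quads: "finite (quads n)"
proof (rule finite_subset)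
  show "quads n \<subseteq> {..n} \<times> {..n} \<times> {..n} \<times> {..n}"
  proof (clarsimp simp: quads_def)
    fix a b x y :: nat
    assume "0 < a" "0 < b" "0 < x" "0 < y"
    then have "a \<le> a * x" "x \<le> a * x" "b \<le> b * y" "y \<le> b * y"
      by simp_all
    then show "a \<le> a * x + b * y \<and> b \<le> a * x + b * y \<and> x \<le> a * x + b * y \<and> y \<le> a * x + b * y"
      by linarith
  qed
qed simp

lemma sum_quads_swap: "(\<Sum>(a, b, x, y) \<in> quads n. h b a y x) = (\<Sum>(a, b, x, y) \<in> quads n. h a b x y)"
  by (rule sum.reindex_bij_witness[of _ "\<lambda>(a, b, x, y). (b, a, y, x)" "\<lambda>(a, b, x, y). (b, a, y, x)"])
     (auto simp: quads_def add.commute)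

text \<open>A divisor \<open>a\<close> of \<open>m\<close> and a divisor \<open>b\<close> of
  \<open>n - m\<close> determine the cofactors \<open>x = m div a\<close> and
  \<open>y = (n - m) div b\<close>; conversely \<open>m = a * x\<close>.\<close>

lemma sum_quads_convolution:
  fixes F G :: "nat \<Rightarrow> int"
  shows "(\<Sum>m = 1..n - 1. (\<Sum>d | d dvd m \<and> d > 0. F d) * (\<Sum>d | d dvd n - m \<and> d > 0. G d))
    = (\<Sum>(a, b, x, y) \<in> quads n. F a * G b)"
proof -
  let ?D = "\<lambda>m. {d. d dvd m \<and> d > 0} :: nat set"
  let ?T = "SIGMA m : {1..n - 1}. ?D m \<times> ?D (n - m)"
  have fin: "finite (?D m)" if "m > 0" for m
    using that by simp
  have "(\<Sum>m = 1..n - 1. (\<Sum>d \<in> ?D m. F d) * (\<Sum>d \<in> ?D (n - m). G d))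
      = (\<Sum>m = 1..n - 1. \<Sum>(a, b) \<in> ?D m \<times> ?D (n - m). F a * G b)"
    by (simp add: sum_product sum.cartesian_product)
  also have "\<dots> = (\<Sum>(m, a, b) \<in> ?T. F a * G b)"
    by (subst sum.Sigma) (auto intro!: fin simp: split_def)
  also have "\<dots> = (\<Sum>(a, b, x, y) \<in> quads n. F a * G b)"
  proof (rule sum.reindex_bij_witness
      [of _ "\<lambda>(a, b, x, y). (a * x, a, b)" "\<lambda>(m, a, b). (a, b, m div a, (n - m) div b)"])
    fix p assume "p \<in> ?T"
    then obtain m a b where p: "p = (m, a, b)" "0 < m" "m < n" "a dvd m" "b dvd n - m"
      "0 < a" "0 < b"
      by auto
    then show "(case p of (m, a, b) \<Rightarrow> (a, b, m div a, (n - m) div b)) \<in> quads n"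
      by (simp add: quads_def dvd_imp_le div_greater_zero_iff)
  next
    fix q assume "q \<in> quads n"
    then obtain a b x y where q: "q = (a, b, x, y)" "0 < a" "0 < b" "0 < x" "0 < y"
      "n = a * x + b * y"
      by (auto simp: quads_def)
    then have "0 < a * x" "0 < b * y"
      by simp_all
    then have "a * x \<in> {1..n - 1}"
      unfolding q(6) by (simp only: atLeastAtMost_iff) linarith
    then show "(case q of (a, b, x, y) \<Rightarrow> (a * x, a, b)) \<in> ?T"
      using q by auto
  qed (auto simp: quads_def)
  finally show ?thesis .
qed

text \<open>For \<open>x = y\<close> the equation reads \<open>(a + b) * x = n\<close>, so
  \<open>d = a + b\<close> is a divisor of \<open>n\<close> and \<open>x\<close> its
  cofactor.\<close>

lemma sum_quads_diagonal:
  fixes h :: "nat \<Rightarrow> nat \<Rightarrow> nat \<Rightarrow> int"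
  assumes "n > 0"
  shows "(\<Sum>(a, b, x, y) \<in> {(a, b, x, y) \<in> quads n. x = y}. h a b x)
    = (\<Sum>d | d dvd n \<and> d > 0. \<Sum>a = 1..<d. h a (d - a) (n div d))"
proof -
  have "(\<Sum>d | d dvd n \<and> d > 0. \<Sum>a = 1..<d. h a (d - a) (n div d))
     = (\<Sum>(d, a) \<in> (SIGMA d : {d. d dvd n \<and> d > 0}. {1..<d}). h a (d - a) (n div d))"
    using assms by (subst sum.Sigma) auto
  also have "\<dots> = (\<Sum>(a, b, x, y) \<in> {(a, b, x, y) \<in> quads n. x = y}. h a b x)"
    using assms
    by (intro sum.reindex_bij_witness
          [of _ "\<lambda>(a, b, x, y). (a + b, a)" "\<lambda>(d, a). (a, d - a, n div d, n div d)"])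
       (auto simp: quads_def distrib_right[symmetric] elim!: dvdE)
  finally show ?thesis by simp
qed

section \<open>Descent by the Euclidean step\<close>

text \<open>By symmetry the sum of \<open>f\<close> is both \<open>2 * A + D\<close> and
  \<open>2 * X + E\<close>, each letter standing for the sum of \<open>f\<close> over that set. The
  step carries \<open>A\<close> onto \<open>X\<close>, so twice the sum of \<open>t\<close> over
  \<open>A\<close> is \<open>2 * A - 2 * X = E - D\<close>. The terms with \<open>a = b\<close>
  restore \<open>D\<close> and leave \<open>E\<close>.\<close>

lemma sum_quads_descent:
  fixes f t :: "nat \<Rightarrow> nat \<Rightarrow> nat \<Rightarrow> nat \<Rightarrow> int"
  assumes fsym: "\<And>a b x y. (a, b, x, y) \<in> quads n \<Longrightarrow> f b a y x = f a b x y"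
    and tsym: "\<And>a b x y. (a, b, x, y) \<in> quads n \<Longrightarrow> t b a y x = t a b x y"
    and above: "\<And>a b x y. (a, b, x, y) \<in> quads n \<Longrightarrow> b < a \<Longrightarrow>
      t a b x y = f a b x y - f (a - b) b x (x + y)"
    and diag: "\<And>a x y. (a, a, x, y) \<in> quads n \<Longrightarrow> t a a x y = f a a x y"
  shows "(\<Sum>(a, b, x, y) \<in> quads n. t a b x y)
    = (\<Sum>(a, b, x, y) \<in> {(a, b, x, y) \<in> quads n. x = y}. f a b x y)"
proof -
  define A where "A = {(a, b, x, y) \<in> quads n. b < a}"
  define A' where "A' = {(a, b, x, y) \<in> quads n. a < b}"
  define D where "D = {(a, b, x, y) \<in> quads n. a = b}"
  define X where "X = {(a, b, x, y) \<in> quads n. x < y}"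
  define X' where "X' = {(a, b, x, y) \<in> quads n. y < x}"
  define E where "E = {(a, b, x, y) \<in> quads n. x = y}"
  note defs = A_def A'_def D_def X_def X'_def E_def
  have subs: "A \<subseteq> quads n" "A' \<subseteq> quads n" "D \<subseteq> quads n" "X \<subseteq> quads n" "X' \<subseteq> quads n" "E \<subseteq> quads n"
    by (auto simp: defs)
  then have fin: "finite A" "finite A'" "finite D" "finite X" "finite X'" "finite E"
    using finite_subset[OF _ finite_quads] by blast+
  have splitA: "(\<Sum>(a, b, x, y) \<in> quads n. h a b x y) = 2 * (\<Sum>(a, b, x, y) \<in> A. h a b x y)
      + (\<Sum>(a, b, x, y) \<in> D. h a b x y)"
    if "\<And>a b x y. (a, b, x, y) \<in> quads n \<Longrightarrow> h b a y x = h a b x y"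
    for h :: "nat \<Rightarrow> nat \<Rightarrow> nat \<Rightarrow> nat \<Rightarrow> int"
  proof -
    have "quads n = A \<union> A' \<union> D"
      by (auto simp: defs)
    moreover have "A \<inter> A' = {}" "(A \<union> A') \<inter> D = {}"
      by (auto simp: defs)
    moreover have "(\<Sum>(a, b, x, y) \<in> A'. h a b x y) = (\<Sum>(a, b, x, y) \<in> A. h a b x y)"
      by (rule sum.reindex_bij_witness[of _ "\<lambda>(a, b, x, y). (b, a, y, x)" "\<lambda>(a, b, x, y). (b, a, y, x)"])
         (auto simp: defs quads_def add.commute intro!: that)
    ultimately show ?thesis
      using fin by (simp add: sum.union_disjoint)
  qed
  have splitX: "(\<Sum>(a, b, x, y) \<in> quads n. f a b x y) = 2 * (\<Sum>(a, b, x, y) \<in> X. f a b x y)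
      + (\<Sum>(a, b, x, y) \<in> E. f a b x y)"
  proof -
    have "quads n = X \<union> X' \<union> E"
      by (auto simp: defs)
    moreover have "X \<inter> X' = {}" "(X \<union> X') \<inter> E = {}"
      by (auto simp: defs)
    moreover have "(\<Sum>(a, b, x, y) \<in> X'. f a b x y) = (\<Sum>(a, b, x, y) \<in> X. f a b x y)"
      by (rule sum.reindex_bij_witness[of _ "\<lambda>(a, b, x, y). (b, a, y, x)" "\<lambda>(a, b, x, y). (b, a, y, x)"])
         (auto simp: defs quads_def add.commute intro!: fsym)
    ultimately show ?thesis
      using fin by (simp add: sum.union_disjoint)
  qed
  have shear: "(\<Sum>(a, b, x, y) \<in> A. f (a - b) b x (x + y)) = (\<Sum>(a, b, x, y) \<in> X. f a b x y)"
    by (rule sum.reindex_bij_witness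
          [of _ "\<lambda>(a, b, x, y). (a + b, b, x, y - x)" "\<lambda>(a, b, x, y). (a - b, b, x, x + y)"])
       (auto simp: defs quads_def algebra_simps less_iff_Suc_add)
  have "(\<Sum>(a, b, x, y) \<in> A. t a b x y) = (\<Sum>(a, b, x, y) \<in> A. f a b x y - f (a - b) b x (x + y))"
    by (rule sum.cong) (auto simp: A_def above)
  also have "\<dots> = (\<Sum>(a, b, x, y) \<in> A. f a b x y) - (\<Sum>(a, b, x, y) \<in> X. f a b x y)"
    using shear by (simp add: split_def sum_subtractf)
  finally have "2 * (\<Sum>(a, b, x, y) \<in> A. t a b x y)
      = (\<Sum>(a, b, x, y) \<in> E. f a b x y) - (\<Sum>(a, b, x, y) \<in> D. f a b x y)"
    using splitX splitA[of f, OF fsym] by simp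
  moreover have "(\<Sum>(a, b, x, y) \<in> D. t a b x y) = (\<Sum>(a, b, x, y) \<in> D. f a b x y)"
    by (rule sum.cong) (auto simp: D_def diag)
  ultimately show ?thesis
    using splitA[of t, OF tsym] by (simp add: E_def)
qed

section \<open>Vanishing sums from moving a factor 2\<close>

text \<open>Moving a factor 2 from \<open>b\<close> to \<open>y\<close> preserves
  \<open>b * y\<close>; the old \<open>b\<close> is twice the new one, whence
  \<open>2 ^ j\<close>.\<close>

lemma sum_quads_even:
  "(\<Sum>(a, b, x, y) \<in> quads n. if even b then F a * int b ^ j else 0)
    = 2 ^ j * (\<Sum>(a, b, x, y) \<in> quads n. if even y then F a * int b ^ j else 0)"
proof -
  have "(\<Sum>(a, b, x, y) \<in> quads n. if even b then F a * int b ^ j else 0)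
      = (\<Sum>(a, b, x, y) \<in> {(a, b, x, y) \<in> quads n. even b}. F a * int b ^ j)"
    by (rule sum.mono_neutral_cong_right[OF finite_quads]) (auto split: if_splits)
  also have "\<dots> = (\<Sum>(a, b, x, y) \<in> {(a, b, x, y) \<in> quads n. even y}. F a * int (2 * b) ^ j)"
    by (rule sum.reindex_bij_witness
          [of _ "\<lambda>(a, b, x, y). (a, 2 * b, x, y div 2)" "\<lambda>(a, b, x, y). (a, b div 2, x, 2 * y)"])
       (auto simp: quads_def elim!: evenE)
  also have "\<dots> = (\<Sum>(a, b, x, y) \<in> quads n. if even y then F a * int (2 * b) ^ j else 0)"
    by (rule sum.mono_neutral_cong_left[OF finite_quads]) (auto split: if_splits)
  also have "\<dots> = 2 ^ j * (\<Sum>(a, b, x, y) \<in> quads n. if even y then F a * int b ^ j else 0)"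
    unfolding sum_distrib_left by (rule sum.cong) (auto simp: power_mult_distrib algebra_simps)
  finally show ?thesis .
qed

definition level_two_relation :: "nat \<Rightarrow> nat \<Rightarrow> nat \<Rightarrow> nat \<Rightarrow> nat \<Rightarrow> nat \<Rightarrow> int" where
  "level_two_relation i j a b x y =
    (if even b then int a ^ i * int b ^ j else 0) - 2 ^ j * (if even y then int a ^ i * int b ^ j else 0)"

lemma sum_level_two_relation: "(\<Sum>(a, b, x, y) \<in> quads n. level_two_relation i j a b x y) = 0"
  using sum_quads_even[of "\<lambda>a. int a ^ i" j n]
  by (simp add: level_two_relation_def split_def sum_subtractf sum_distrib_left)

section \<open>The potential and its six parity classes\<close>

text \<open>
  These polynomials, and the factors 36 and 72 in \<open>summand\<close>, solve the linear system for the
  coefficients of \<open>f\<close> and of the vanishing terms. Its solution space has dimension three; this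
  solution was chosen because it is divisible by \<open>a^2 b^2\<close>.
\<close>

definition upol :: "int \<Rightarrow> int \<Rightarrow> int" where
  "upol a b = a^2 * b^2 * (64 * b^6 + 256 * a * b^5 - 52 * a^2 * b^4 - 1628 * a^3 * b^3
     - 2905 * a^4 * b^2 - 2030 * a^5 * b - 509 * a^6)"

definition vpol :: "int \<Rightarrow> int \<Rightarrow> int" where
  "vpol a b = a^2 * b^2 * (64 * b^6 + 256 * a * b^5 - 52 * a^2 * b^4 - 476 * a^3 * b^3
     - 25 * a^4 * b^2 + 274 * a^5 * b + 67 * a^6)"

definition wpol :: "int \<Rightarrow> int \<Rightarrow> int" where
  "wpol a b = a^2 * b^2 * (67 * b^6 + 262 * a * b^5 - 67 * a^2 * b^4 - 1676 * a^3 * b^3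
     - 2947 * a^4 * b^2 - 2042 * a^5 * b - 509 * a^6)"

definition potential :: "nat \<Rightarrow> nat \<Rightarrow> nat \<Rightarrow> nat \<Rightarrow> int" where
  "potential a b x y =
    (if even a then (if even x then upol (int a) (int b) else vpol (int a) (int b))
     else if even b then (if even y then upol (int b) (int a) else vpol (int b) (int a))
     else (if even x then wpol (int a) (int b) else wpol (int b) (int a)))"

text \<open>The coefficients of the theorem divided by 360: \<open>186480 = 360 * 518\<close> and
  \<open>2160 = 360 * 6\<close>. The sign is the product of the signs in the two alternating divisor
  sums.\<close>

definition weight :: "nat \<Rightarrow> nat \<Rightarrow> int" where
  "weight a b = 518 + 6 * (-1) ^ (a + b)"

text \<open>Symmetrised under exchange of \<open>(a, x)\<close> with \<open>(b, y)\<close>, as the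
  descent requires. This doubles the convolution sums, so the factor 360 becomes 180.\<close>

definition summand :: "nat \<Rightarrow> nat \<Rightarrow> nat \<Rightarrow> nat \<Rightarrow> int" where
  "summand a b x y =
    weight a b * (int a ^ 3 * int b ^ 7 + int a ^ 7 * int b ^ 3 - 2 * (int a ^ 5 * int b ^ 5))
    + 36 * (level_two_relation 3 7 a b x y + level_two_relation 3 7 b a y x)
    + 72 * (level_two_relation 5 5 a b x y + level_two_relation 5 5 b a y x)"

text \<open>One identity per parity class, in the order of the cases in \<open>summand_eq\<close>.
  Here 512 and 524 are the values of \<open>weight\<close> for odd and even \<open>a + b\<close>.
  The other coefficients are 36 (with \<open>j = 7\<close>) or 72 (with \<open>j = 5\<close>) times
  \<open>1 - 2 ^ j\<close>, \<open>1\<close> or \<open>- (2 ^ j)\<close>.\<close>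

lemma polynomial_relations:
  fixes a b :: int
  defines "p \<equiv> a^3 * b^7 + a^7 * b^3 - 2 * (a^5 * b^5)"
  shows "upol a b = wpol (a - b) b + 512 * p - 4572 * (b^3 * a^7) - 2232 * (a^5 * b^5)"
    and "vpol a b = wpol b (a - b) + 512 * p + 36 * (b^3 * a^7) + 72 * (a^5 * b^5)"
    and "upol b a = vpol b (a - b) + 512 * p - 4572 * (a^3 * b^7) - 2232 * (a^5 * b^5)"
    and "vpol b a = upol b (a - b) + 512 * p + 36 * (a^3 * b^7) + 72 * (a^5 * b^5)"
    and "wpol a b = upol (a - b) b + 524 * p - 4608 * (b^3 * a^7) - 2304 * (a^5 * b^5)"
    and "wpol b a = vpol (a - b) b + 524 * p - 4608 * (a^3 * b^7) - 2304 * (a^5 * b^5)"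
  unfolding p_def upol_def vpol_def wpol_def by algebra+

lemma summand_eq:
  assumes q: "(a, b, x, y) \<in> quads n" and n: "odd n" and ab: "b \<le> a"
  shows "summand a b x y = potential a b x y - potential (a - b) b x (x + y)"
proof -
  have "odd (a * x + b * y)"
    using q n by (simp add: quads_def)
  then consider
      (1) "even a" "odd b" "even x" "odd y"
    | (2) "even a" "odd b" "odd x" "odd y"
    | (3) "odd a" "even b" "odd x" "even y"
    | (4) "odd a" "even b" "odd x" "odd y"
    | (5) "odd a" "odd b" "even x" "odd y"
    | (6) "odd a" "odd b" "odd x" "even y"
    by (cases "even a"; cases "even b"; cases "even x"; cases "even y") simp_all
  then show ?thesis
    using ab polynomial_relations[where a = "int a" and b = "int b"]
    by cases (simp_all add: summand_def potential_def weight_def level_two_relation_def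
        of_nat_diff algebra_simps)
qed

section \<open>Evaluation on the diagonal \<open>x = y\<close>\<close>

text \<open>
  \<open>R\<close> comes from Faulhaber's formula for the powers of \<open>k\<close>, written in \<open>s = 2 K + 1\<close> so that the sum
  needed below is \<open>R d\<close>.
\<close>

lemma sum_vpol:
  fixes d :: int
  defines "R \<equiv> \<lambda>s. d^2 * (
      d * (776475 - 1887900 * s^2 + 1492050 * s^4 - 426300 * s^6 + 45675 * s^8)
    + d^3 * (- 146520 + 341880 * s^2 - 244200 * s^4 + 48840 * s^6)
    + d^5 * (- 11520 + 23040 * s^2 - 11520 * s^4)
    + (- 775716 * s + 1262320 * s^3 - 598584 * s^5 + 122160 * s^7 - 10180 * s^9)
    + d^2 * (771900 * s - 1220100 * s^3 + 522900 * s^5 - 74700 * s^7)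
    + d^4 * (- 4368 * s + 6240 * s^3 - 1872 * s^5)
    + d^6 * (- 3840 * s + 3840 * s^3))"
  shows "360 * (\<Sum>k = 1..K. vpol (2 * int k) (d - 2 * int k)) = R (2 * int K + 1)"
proof (induction K)
  case 0
  show ?case by (simp add: R_def)
next
  case (Suc K)
  have "360 * vpol (2 * (1 + k)) (d - 2 * (1 + k)) + R (2 * k + 1) = R (2 * (1 + k) + 1)" for k
    unfolding R_def vpol_def by algebra
  from this[of "int K"] Suc show ?case
    by (simp add: distrib_left)
qed

text \<open>Exactly one of \<open>a\<close> and \<open>d - a\<close> is even and \<open>x\<close> is
  odd, so every term is \<open>vpol\<close> with the even part as first argument. Each even part
  occurs twice, once for each order.\<close>

lemma sum_diagonal_potential:
  assumes "odd d" "odd x"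
  shows "180 * (\<Sum>a = 1..<d. potential a (d - a) x x)
    = 759 * int d ^ 3 - 200 * int d ^ 5 - 642 * int d ^ 7 + 83 * int d ^ 11"
proof -
  obtain K where d: "d = 2 * K + 1"
    using assms oddE by blast
  define h where "h k = vpol (2 * int k) (int d - 2 * int k)" for k
  let ?E = "{a \<in> {1..<d}. even a}" and ?O = "{a \<in> {1..<d}. odd a}"
  have "(\<Sum>a = 1..<d. potential a (d - a) x x) = (\<Sum>a \<in> ?E \<union> ?O. potential a (d - a) x x)"
    by (rule sum.cong) auto
  also have "\<dots> = (\<Sum>a \<in> ?E. potential a (d - a) x x) + (\<Sum>a \<in> ?O. potential a (d - a) x x)"
    by (rule sum.union_disjoint) auto
  also have "(\<Sum>a \<in> ?E. potential a (d - a) x x) = (\<Sum>k = 1..K. h k)"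
    by (rule sum.reindex_bij_witness[of _ "\<lambda>k. 2 * k" "\<lambda>a. a div 2"])
       (use assms in \<open>auto simp: d h_def potential_def of_nat_diff elim!: evenE\<close>)
  \<comment> \<open>Here \<open>d - a\<close> is the even part, and
    \<open>k = (d - a) div 2 = K - a div 2\<close>.\<close>
  also have "(\<Sum>a \<in> ?O. potential a (d - a) x x) = (\<Sum>k = 1..K. h k)"
    by (rule sum.reindex_bij_witness[of _ "\<lambda>k. 2 * (K - k) + 1" "\<lambda>a. K - a div 2"])
       (use assms in \<open>auto simp: d h_def potential_def of_nat_diff elim!: oddE\<close>)
  finally have "180 * (\<Sum>a = 1..<d. potential a (d - a) x x) = 360 * (\<Sum>k = 1..K. h k)"
    by simp
  also have "\<dots> = 759 * int d ^ 3 - 200 * int d ^ 5 - 642 * int d ^ 7 + 83 * int d ^ 11"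
  proof -
    have s: "2 * int K + 1 = int d"
      by (simp add: d)
    show ?thesis
      unfolding h_def sum_vpol s by algebra
  qed
  finally show ?thesis .
qed

lemma sum_summand:
  assumes "odd n"
  shows "180 * (\<Sum>(a, b, x, y) \<in> quads n. summand a b x y)
    = 759 * divisor_sigma 3 n - 200 * divisor_sigma 5 n - 642 * divisor_sigma 7 n + 83 * divisor_sigma 11 n"
proof -
  have "n > 0"
    using assms by (rule odd_pos)
  have "(\<Sum>(a, b, x, y) \<in> quads n. summand a b x y)
      = (\<Sum>(a, b, x, y) \<in> {(a, b, x, y) \<in> quads n. x = y}. potential a b x y)"
  proof (rule sum_quads_descent)
    fix a b x y assume q: "(a, b, x, y) \<in> quads n"
    then have odd: "odd (a * x + b * y)"
      using assms by (simp add: quads_def)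
    \<comment> \<open>Oddness excludes \<open>a\<close> and \<open>b\<close> both even, and for
      \<open>a\<close> and \<open>b\<close> both odd it makes exactly one of \<open>x\<close> and
      \<open>y\<close> even.\<close>
    then show "potential b a y x = potential a b x y"
      by (auto simp: potential_def)
    show "summand b a y x = summand a b x y"
      by (simp add: summand_def weight_def add.commute mult.commute)
    show "summand a b x y = potential a b x y - potential (a - b) b x (x + y)" if "b < a"
      using summand_eq[OF q assms] that by simp
  next
    fix a x y assume q: "(a, a, x, y) \<in> quads n"
    show "summand a a x y = potential a a x y"
      \<comment> \<open>The step leads to first argument \<open>a - a = 0\<close>, where the factor
        \<open>a^2\<close> makes the potential vanish.\<close>
      using summand_eq[OF q assms] by (simp add: potential_def upol_def vpol_def wpol_def)
  qed
  also have "\<dots> = (\<Sum>(a, b, x, y) \<in> {(a, b, x, y) \<in> quads n. x = y}. potential a b x x)"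
    by (rule sum.cong) auto
  also have "\<dots> = (\<Sum>d | d dvd n \<and> d > 0. \<Sum>a = 1..<d. potential a (d - a) (n div d) (n div d))"
    by (rule sum_quads_diagonal[OF \<open>n > 0\<close>])
  finally have "180 * (\<Sum>(a, b, x, y) \<in> quads n. summand a b x y)
      = (\<Sum>d | d dvd n \<and> d > 0. 180 * (\<Sum>a = 1..<d. potential a (d - a) (n div d) (n div d)))"
    by (simp add: sum_distrib_left)
  also have "\<dots> = (\<Sum>d | d dvd n \<and> d > 0.
      759 * int d ^ 3 - 200 * int d ^ 5 - 642 * int d ^ 7 + 83 * int d ^ 11)"
    \<comment> \<open>Divisors of the odd \<open>n\<close> and their cofactors are odd.\<close>
    using assms by (intro sum.cong refl sum_diagonal_potential) (auto elim!: dvdE)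
  also have "\<dots> = 759 * divisor_sigma 3 n - 200 * divisor_sigma 5 n - 642 * divisor_sigma 7 n
      + 83 * divisor_sigma 11 n"
    by (simp add: divisor_sigma_def sum.distrib sum_subtractf sum_distrib_left)
  finally show ?thesis .
qed

section \<open>Return to the convolution sums\<close>

theorem corollary1p11:
  fixes n :: nat
  assumes "n > 0" and "odd n"
  shows "2160 * (\<Sum>m = 1..n - 1. divisor_sigma_dagger 3 m * divisor_sigma_dagger 7 (n - m)
                                 - divisor_sigma_dagger 5 m * divisor_sigma_dagger 5 (n - m))
       + 186480 * (\<Sum>m = 1..n - 1. divisor_sigma 3 m * divisor_sigma 7 (n - m)
                                   - divisor_sigma 5 m * divisor_sigma 5 (n - m))
       = 759 * divisor_sigma 3 n - 200 * divisor_sigma 5 n - 642 * divisor_sigma 7 n + 83 * divisor_sigma 11 n"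
proof -
  define T where "T i j = (\<Sum>(a, b, x, y) \<in> quads n. weight a b * (int a ^ i * int b ^ j))" for i j
  have conv: "2160 * (\<Sum>m = 1..n - 1. divisor_sigma_dagger i m * divisor_sigma_dagger j (n - m))
      + 186480 * (\<Sum>m = 1..n - 1. divisor_sigma i m * divisor_sigma j (n - m)) = 360 * T i j" for i j
    unfolding divisor_sigma_def divisor_sigma_dagger_def sum_quads_convolution T_def weight_def
    by (simp add: split_def sum_distrib_left sum_distrib_right sum.distrib power_add algebra_simps)
  have swap: "T 7 3 = T 3 7"
    using sum_quads_swap[where h = "\<lambda>a b x y. weight a b * (int a ^ 3 * int b ^ 7)" and n = n]
    by (simp add: T_def weight_def add.commute mult.commute)
  have rel: "(\<Sum>(a, b, x, y) \<in> quads n. level_two_relation i j b a y x) = 0" for i j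
    using sum_quads_swap[where h = "level_two_relation i j" and n = n]
    by (simp add: sum_level_two_relation)
  have "(\<Sum>(a, b, x, y) \<in> quads n. summand a b x y)
      = T 3 7 + T 7 3 - 2 * T 5 5
        + 36 * ((\<Sum>(a, b, x, y) \<in> quads n. level_two_relation 3 7 a b x y)
          + (\<Sum>(a, b, x, y) \<in> quads n. level_two_relation 3 7 b a y x))
        + 72 * ((\<Sum>(a, b, x, y) \<in> quads n. level_two_relation 5 5 a b x y)
          + (\<Sum>(a, b, x, y) \<in> quads n. level_two_relation 5 5 b a y x))"
    unfolding T_def summand_def
    by (simp add: split_def sum_distrib_left sum.distrib[symmetric] sum_subtractf[symmetric] algebra_simps)
  then have "180 * (\<Sum>(a, b, x, y) \<in> quads n. summand a b x y) = 360 * T 3 7 - 360 * T 5 5"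
    by (simp add: rel sum_level_two_relation swap)
  then show ?thesis
    using conv[of 3 7] conv[of 5 5] sum_summand[OF \<open>odd n\<close>]
    by (simp add: sum_subtractf)
qed

end
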